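(* For all real $p,q\ge 0$, the function $(x,y)\mapsto B_{p,q}(x,y)$ is logarithmically convex on $(0,\infty)\times(0,\infty)$. In particular, for all $x_1,x_2,y_1,y_2>0$, $$B_{p,q}\Big(\frac{x_1+x_2}{2},\frac{y_1+y_2}{2}\Big)^2\le B_{p,q}(x_1,y_1)\,B_{p,q}(x_2,y_2).$$
   Context: For real $p,q\ge 0$ and $x,y>0$, the extended $(p,q)$-beta function is $$B_{p,q}(x,y)=\int_0^1 t^{x-1}(1-t)^{y-1}\exp\Big(-\frac{p}{t}-\frac{q}{1-t}\Big)\,dt .$$ A function $f>0$ on a convex set is logarithmically convex if $f(\alpha u+(1-\alpha)v)\le f(u)^{\alpha}f(v)^{1-\alpha}$ for all $u,v$ in the set and all $\alpha\in(0,1)$. *)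

theory Defs
  imports "HOL-Analysis.Analysis"
begin

(* Lebesgue integral over the open interval, so the values of t powr a and p / t at the
   endpoints play no role and integrable endpoint singularities (p = 0, x < 1 or
   q = 0, y < 1) are covered. *)
definition ext_Beta :: "real \<Rightarrow> real \<Rightarrow> real \<Rightarrow> real \<Rightarrow> real" where
  "ext_Beta p q x y =
     (LBINT t:{0<..<1}. t powr (x - 1) * (1 - t) powr (y - 1) * exp (- p / t - q / (1 - t)))"

definition log_convex_on :: "'a::real_vector set \<Rightarrow> ('a \<Rightarrow> real) \<Rightarrow> bool" where
  "log_convex_on S f \<longleftrightarrow> convex S \<and> (\<forall>u\<in>S. f u > 0) \<and>
     (\<forall>u\<in>S. \<forall>v\<in>S. \<forall>\<alpha>\<in>{0<..<1}.
        f (\<alpha> *\<^sub>R u + (1 - \<alpha>) *\<^sub>R v) \<le> f u powr \<alpha> * f v powr (1 - \<alpha>))"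

end

theory Submission
  imports Defs
begin

text \<open>
  For fixed \<open>t\<close> in the open unit interval, the logarithm of the integrand is affine in
  \<open>(x, y)\<close>: the parameters enter only through the exponents of \<open>t\<close> and \<open>1 - t\<close>, while the
  factor \<open>exp (- p / t - q / (1 - t))\<close> is constant and so equals the product of its own powers
  with exponents \<open>\<alpha>\<close> and \<open>1 - \<alpha>\<close>. The integrand at a convex combination is therefore exactly
  the weighted geometric mean of the integrands at the two end points
  (\<open>ext_beta_integrand_convex_comb\<close>), and Hoelder's inequality
  (\<open>integral_geometric_mean_le\<close>) says that the integral of a geometric mean is at most
  the geometric mean of the integrals. The midpoint inequality is the case \<open>\<alpha> = 1/2\<close>, squared.

  Hoelder's inequality needs finite integrals, which is where \<open>p, q \<ge> 0\<close> enters: the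
  exponential factor is then at most 1, so the integrand is dominated by that of the ordinary
  Beta integral.
\<close>

text \<open>
  This is Hoelder's inequality with exponents \<open>1 / \<alpha>\<close> and \<open>1 / (1 - \<alpha>)\<close>, stated for the powers.
  After \<open>f\<close> and \<open>g\<close> are normalised to have integral 1, it follows by integrating the
  weighted inequality between the geometric and arithmetic means.
\<close>

lemma integral_geometric_mean_le:
  fixes f g :: "'a \<Rightarrow> real"
  assumes f: "integrable M f" "\<And>t. f t \<ge> 0" "integral\<^sup>L M f > 0"
    and g: "integrable M g" "\<And>t. g t \<ge> 0" "integral\<^sup>L M g > 0"
    and \<alpha>: "0 < \<alpha>" "\<alpha> < 1"
  shows "(\<integral>t. f t powr \<alpha> * g t powr (1 - \<alpha>) \<partial>M)
           \<le> integral\<^sup>L M f powr \<alpha> * integral\<^sup>L M g powr (1 - \<alpha>)"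
proof -
  let ?F = "integral\<^sup>L M f" and ?G = "integral\<^sup>L M g"
  let ?C = "?F powr \<alpha> * ?G powr (1 - \<alpha>)"
  let ?mean = "\<lambda>t. \<alpha> * (f t / ?F) + (1 - \<alpha>) * (g t / ?G)"
  have pointwise: "f t powr \<alpha> * g t powr (1 - \<alpha>) \<le> ?C * ?mean t" for t
  proof (cases "f t = 0 \<or> g t = 0")
    case True
    then have "f t powr \<alpha> * g t powr (1 - \<alpha>) = 0"
      by auto
    moreover have "0 \<le> ?C * ?mean t"
      using f(2)[of t] g(2)[of t] f(3) g(3) \<alpha> by simp
    ultimately show ?thesis
      by (simp only:)
  next
    case False
    then have pos: "f t > 0" "g t > 0"
      using f(2)[of t] g(2)[of t] by auto
    have "f t powr \<alpha> * g t powr (1 - \<alpha>)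
            = ?C * ((f t / ?F) powr \<alpha> * (g t / ?G) powr (1 - \<alpha>))"
      using pos f(3) g(3) by (simp add: powr_divide)
    also have "\<dots> \<le> ?C * ?mean t"
      using pos f(3) g(3) \<alpha> by (intro mult_left_mono Youngs_inequality_0) auto
    finally show ?thesis .
  qed
  have "(\<integral>t. f t powr \<alpha> * g t powr (1 - \<alpha>) \<partial>M) \<le> (\<integral>t. ?C * ?mean t \<partial>M)"
  proof (rule integral_mono')
    show "integrable M (\<lambda>t. ?C * ?mean t)"
      using f(1) g(1) by simp
  next
    fix t
    show "0 \<le> ?C * ?mean t"
      using f(2)[of t] g(2)[of t] f(3) g(3) \<alpha> by simp
  qed (use pointwise in simp)
  also have "\<dots> = ?C"
    using f(1,3) g(1,3) by simp
  finally show ?thesis .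
qed

text \<open>
  Extending the integrand by zero outside the open unit interval turns the set integral into
  an integral over the whole line; the extension is compatible with geometric means because
  \<open>0 powr a = 0\<close>.
\<close>

definition ext_beta_integrand :: "real \<Rightarrow> real \<Rightarrow> real \<Rightarrow> real \<Rightarrow> real \<Rightarrow> real" where
  "ext_beta_integrand p q x y t = indicator {0<..<1} t *
     (t powr (x - 1) * (1 - t) powr (y - 1) * exp (- p / t - q / (1 - t)))"

lemma ext_Beta_eq_integral: "ext_Beta p q x y = integral\<^sup>L lborel (ext_beta_integrand p q x y)"
  by (simp add: ext_Beta_def set_lebesgue_integral_def ext_beta_integrand_def[abs_def])

lemma ext_beta_integrand_nonneg: "ext_beta_integrand p q x y t \<ge> 0"
  by (simp add: ext_beta_integrand_def)

lemma ext_beta_integrand_convex_comb: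
  "ext_beta_integrand p q (\<alpha> * x1 + (1 - \<alpha>) * x2) (\<alpha> * y1 + (1 - \<alpha>) * y2) t
     = ext_beta_integrand p q x1 y1 t powr \<alpha> * ext_beta_integrand p q x2 y2 t powr (1 - \<alpha>)"
proof (cases "t \<in> {0<..<1}")
  case False
  then show ?thesis
    by (simp add: ext_beta_integrand_def)
next
  case True
  define c where "c = - p / t - q / (1 - t)"
  have expand: "ext_beta_integrand p q x y t = exp ((x - 1) * ln t + (y - 1) * ln (1 - t) + c)"
    for x y
    using True by (simp add: ext_beta_integrand_def powr_def exp_add c_def)
  show ?thesis
    unfolding expand by (simp add: powr_def flip: exp_add) (simp add: algebra_simps)
qed

lemma integrable_ext_beta_integrand:
  assumes "p \<ge> 0" "q \<ge> 0" "x > 0" "y > 0"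
  shows "integrable lborel (ext_beta_integrand p q x y)"
proof (rule Bochner_Integration.integrable_bound)
  let ?beta = "\<lambda>t. indicator {0..1} t *\<^sub>R (t powr (x - 1) * (1 - t) powr (y - 1)) :: real"
  show "integrable lborel ?beta"
    using integrable_Beta[OF assms(3,4)] by (simp add: set_integrable_def)
  show "ext_beta_integrand p q x y \<in> borel_measurable lborel"
    unfolding ext_beta_integrand_def[abs_def] by measurable
  show "AE t in lborel. norm (ext_beta_integrand p q x y t) \<le> norm (?beta t)"
  proof (rule AE_I2)
    fix t :: real
    show "norm (ext_beta_integrand p q x y t) \<le> norm (?beta t)"
    proof (cases "t \<in> {0<..<1}")
      case True
      then have "p / t \<ge> 0" "q / (1 - t) \<ge> 0"
        using assms by auto
      then have "exp (- p / t - q / (1 - t)) \<le> 1"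
        by simp
      then show ?thesis
        using True by (simp add: ext_beta_integrand_def mult_left_le)
    qed (simp add: ext_beta_integrand_def)
  qed
qed

lemma ext_Beta_pos:
  assumes "p \<ge> 0" "q \<ge> 0" "x > 0" "y > 0"
  shows "ext_Beta p q x y > 0"
proof (rule ccontr)
  assume "\<not> ext_Beta p q x y > 0"
  moreover have "integral\<^sup>L lborel (ext_beta_integrand p q x y) \<ge> 0"
    by (simp add: ext_beta_integrand_nonneg)
  ultimately have "integral\<^sup>L lborel (ext_beta_integrand p q x y) = 0"
    by (simp add: ext_Beta_eq_integral)
  then have "AE t in lborel. ext_beta_integrand p q x y t = 0"
    using integral_nonneg_eq_0_iff_AE[OF integrable_ext_beta_integrand[OF assms]]
    by (simp add: ext_beta_integrand_nonneg)
  then have "AE t::real in lborel. t \<notin> {0<..<1}"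
    by eventually_elim (auto simp: ext_beta_integrand_def)
  then have "emeasure lborel {0<..<1::real} = 0"
    by (subst (asm) AE_iff_measurable[where N = "{0<..<1}"]) auto
  then show False
    by simp
qed

lemma ext_Beta_convex_comb_le:
  assumes "p \<ge> 0" "q \<ge> 0" and "x1 > 0" "y1 > 0" "x2 > 0" "y2 > 0" and "0 < \<alpha>" "\<alpha> < 1"
  shows "ext_Beta p q (\<alpha> * x1 + (1 - \<alpha>) * x2) (\<alpha> * y1 + (1 - \<alpha>) * y2)
           \<le> ext_Beta p q x1 y1 powr \<alpha> * ext_Beta p q x2 y2 powr (1 - \<alpha>)"
proof -
  have "ext_Beta p q (\<alpha> * x1 + (1 - \<alpha>) * x2) (\<alpha> * y1 + (1 - \<alpha>) * y2)
          = (\<integral>t. ext_beta_integrand p q x1 y1 t powr \<alpha>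
                * ext_beta_integrand p q x2 y2 t powr (1 - \<alpha>) \<partial>lborel)"
    by (simp only: ext_Beta_eq_integral flip: ext_beta_integrand_convex_comb)
  also have "\<dots> \<le> ext_Beta p q x1 y1 powr \<alpha> * ext_Beta p q x2 y2 powr (1 - \<alpha>)"
    unfolding ext_Beta_eq_integral using assms
    by (intro integral_geometric_mean_le integrable_ext_beta_integrand ext_beta_integrand_nonneg
        ext_Beta_pos[unfolded ext_Beta_eq_integral])
  finally show ?thesis .
qed

theorem theorem3:
  fixes p q :: real
  assumes "p \<ge> 0" and "q \<ge> 0"
  shows "log_convex_on ({0<..} \<times> {0<..}) (\<lambda>(x, y). ext_Beta p q x y) \<and>
    (\<forall>x1 x2 y1 y2. x1 > 0 \<longrightarrow> x2 > 0 \<longrightarrow> y1 > 0 \<longrightarrow> y2 > 0 \<longrightarrow>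
       (ext_Beta p q ((x1 + x2) / 2) ((y1 + y2) / 2))\<^sup>2
         \<le> ext_Beta p q x1 y1 * ext_Beta p q x2 y2)"
proof (intro conjI allI impI)
  show "log_convex_on ({0<..} \<times> {0<..}) (\<lambda>(x, y). ext_Beta p q x y)"
    unfolding log_convex_on_def
    using assms by (auto intro!: convex_Times ext_Beta_pos ext_Beta_convex_comb_le)
next
  fix x1 x2 y1 y2 :: real
  assume pos: "x1 > 0" "x2 > 0" "y1 > 0" "y2 > 0"
  let ?m = "ext_Beta p q ((x1 + x2) / 2) ((y1 + y2) / 2)"
  let ?B1 = "ext_Beta p q x1 y1" and ?B2 = "ext_Beta p q x2 y2"
  have B_pos: "?m > 0" "?B1 > 0" "?B2 > 0"
    using assms pos by (auto intro!: ext_Beta_pos)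
  have "?m \<le> ?B1 powr (1/2) * ?B2 powr (1/2)"
    using ext_Beta_convex_comb_le[OF assms pos(1,3,2,4), of "1/2"]
    by (simp add: add_divide_distrib)
  also have "\<dots> = sqrt (?B1 * ?B2)"
    using B_pos by (simp add: powr_half_sqrt real_sqrt_mult)
  finally have "?m\<^sup>2 \<le> (sqrt (?B1 * ?B2))\<^sup>2"
    using B_pos by (intro power_mono) auto
  then show "?m\<^sup>2 \<le> ?B1 * ?B2"
    using B_pos by simp
qed

end
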